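(* Let $\mathbf{A}$ be a normal and quasicomplemented distributive nearlattice and let $F,G$ be $\alpha$-filters of $A$. Then \[ \alpha(F\veebar G)=\{x\in A\colon \exists (f,g)\in F\times G\ [\,x\in (f^{\top}\cap g^{\top})^{\top}\,]\}. \]
   Context: A distributive nearlattice is a join-semilattice $\langle A,\vee,1\rangle$ with greatest element $1$ in which every principal filter $[a)=\{x\in A\colon a\le x\}$ is a bounded distributive lattice. A filter of $A$ is a subset containing $1$, upward closed, and closed under those binary meets $a\wedge b$ that exist in $A$. For filters $F,G$, $F\veebar G$ is the smallest filter containing $F\cup G$ (it consists of all existing meets $x_1\wedge\dots\wedge x_n$ of elements $x_i$ lying above some element of $F\cup G$). For $a\in A$, $a^{\top}=\{x\in A\colon x\vee a=1\}$ and $a^{\top\top}=\{y\in A\colon y\vee x=1\text{ for all }x\in a^{\top}\}$; for a filter $H$, $H^{\top}=\{x\in A\colon x\vee h=1\text{ for all }h\in H\}$ (so $(f^{\top}\cap g^{\top})^{\top}$ is this applied to the filter $f^{\top}\cap g^{\top}$). A filter $F$ is an $\alpha$-filter if $a^{\top\top}\subseteq F$ for all $a\in F$. For a filter $H$, $\alpha(H)=\{x\in A\colon \exists a\in H\ (a^{\top}\subseteq x^{\top})\}$ (in a normal distributive nearlattice this is the smallest $\alpha$-filter containing $H$). A prime ideal is a non-empty proper downward closed, $\vee$-closed subset $P$ with $a\wedge b\in P\Rightarrow a\in P$ or $b\in P$ whenever $a\wedge b$ exists; a maximal ideal is a maximal proper non-empty such subset (ideal). $\mathbf{A}$ is normal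 if each prime ideal is contained in a unique maximal ideal; $\mathbf{A}$ is quasicomplemented if for each $a\in A$ there exists $b\in A$ with $a^{\top\top}=b^{\top}$. *)

theory Defs
  imports Main
begin

context order
begin

definition is_meet_in :: "'a set \<Rightarrow> 'a \<Rightarrow> 'a \<Rightarrow> 'a \<Rightarrow> bool" where
  "is_meet_in S x y m \<longleftrightarrow>
     m \<in> S \<and> m \<le> x \<and> m \<le> y \<and> (\<forall>l\<in>S. l \<le> x \<and> l \<le> y \<longrightarrow> l \<le> m)"

abbreviation is_meet :: "'a \<Rightarrow> 'a \<Rightarrow> 'a \<Rightarrow> bool" where
  "is_meet \<equiv> is_meet_in UNIV"

end

text \<open>
  The carrier is the whole type, and the greatest element \<open>1\<close> is \<^const>\<open>top\<close>.
  The principal filter \<open>{a..}\<close> always has the bounds \<open>a\<close> and \<open>top\<close>, and its joins are those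
  of the ambient semilattice. What remains to be required is that binary meets exist in
  \<open>{a..}\<close> and that they distribute over joins.
\<close>

class distributive_nearlattice = semilattice_sup + order_top +
  assumes principal_filter_meet_exists:
      "x \<in> {a..} \<Longrightarrow> y \<in> {a..} \<Longrightarrow> \<exists>m. is_meet_in {a..} x y m"
    and principal_filter_distrib:
      "x \<in> {a..} \<Longrightarrow> y \<in> {a..} \<Longrightarrow> z \<in> {a..} \<Longrightarrow>
       is_meet_in {a..} x (sup y z) m \<Longrightarrow> is_meet_in {a..} x y p \<Longrightarrow> is_meet_in {a..} x z q \<Longrightarrow>
       m = sup p q"
begin

definition nl_filter :: "'a set \<Rightarrow> bool" where
  "nl_filter F \<longleftrightarrow> top \<in> F \<and> (\<forall>a\<in>F. \<forall>b. a \<le> b \<longrightarrow> b \<in> F) \<and>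
     (\<forall>a\<in>F. \<forall>b\<in>F. \<forall>m. is_meet a b m \<longrightarrow> m \<in> F)"

definition filter_join :: "'a set \<Rightarrow> 'a set \<Rightarrow> 'a set" where
  "filter_join F G = \<Inter>{H. nl_filter H \<and> F \<union> G \<subseteq> H}"

definition ann :: "'a \<Rightarrow> 'a set" where
  "ann a = {x. sup x a = top}"

definition set_ann :: "'a set \<Rightarrow> 'a set" where
  "set_ann H = {x. \<forall>h\<in>H. sup x h = top}"

definition double_ann :: "'a \<Rightarrow> 'a set" where
  "double_ann a = {y. \<forall>x\<in>ann a. sup y x = top}"

definition alpha_filter :: "'a set \<Rightarrow> bool" where
  "alpha_filter F \<longleftrightarrow> nl_filter F \<and> (\<forall>a\<in>F. double_ann a \<subseteq> F)"

definition alpha :: "'a set \<Rightarrow> 'a set" where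
  "alpha H = {x. \<exists>a\<in>H. ann a \<subseteq> ann x}"

definition nl_ideal :: "'a set \<Rightarrow> bool" where
  "nl_ideal I \<longleftrightarrow> I \<noteq> {} \<and> (\<forall>a\<in>I. \<forall>b. b \<le> a \<longrightarrow> b \<in> I) \<and>
     (\<forall>a\<in>I. \<forall>b\<in>I. sup a b \<in> I)"

definition nl_prime_ideal :: "'a set \<Rightarrow> bool" where
  "nl_prime_ideal P \<longleftrightarrow> nl_ideal P \<and> P \<noteq> UNIV \<and>
     (\<forall>a b m. is_meet a b m \<and> m \<in> P \<longrightarrow> a \<in> P \<or> b \<in> P)"

definition nl_maximal_ideal :: "'a set \<Rightarrow> bool" where
  "nl_maximal_ideal M \<longleftrightarrow> nl_ideal M \<and> M \<noteq> UNIV \<and>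
     (\<forall>I. nl_ideal I \<and> I \<noteq> UNIV \<and> M \<subseteq> I \<longrightarrow> I = M)"

end

class normal_nearlattice = distributive_nearlattice +
  assumes normal: "nl_prime_ideal P \<Longrightarrow> \<exists>!M. nl_maximal_ideal M \<and> P \<subseteq> M"

class quasicomplemented_nearlattice = distributive_nearlattice +
  assumes quasicomplemented: "\<exists>b. double_ann a = ann b"

end

theory Submission
  imports Defs
begin

text \<open>
  An element of \<open>filter_join F G\<close> is an existing meet \<open>f \<sqinter> g\<close> with \<open>f \<in> F\<close> and \<open>g \<in> G\<close>, and
  distributivity gives \<open>ann (f \<sqinter> g) = ann f \<inter> ann g\<close>; this yields one inclusion. For the other
  one, \<open>f \<sqinter> g\<close> need not exist, but \<open>a = (x \<squnion> f) \<sqinter> (x \<squnion> g)\<close> does, since both elements lie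
  above \<open>x\<close>. If \<open>y \<in> ann a\<close>, then \<open>y \<squnion> x \<in> ann f \<inter> ann g \<subseteq> ann x\<close>, that is, \<open>y \<in> ann x\<close>.
\<close>

context distributive_nearlattice
begin

text \<open>A common lower bound \<open>l\<close> need not lie in \<open>{a..}\<close>, but
  \<open>sup l a\<close> does, and it is still below \<open>x\<close> and \<open>y\<close>.\<close>

lemma is_meet_in_principal_filter_iff:
  assumes "a \<le> x" "a \<le> y"
  shows "is_meet_in {a..} x y m \<longleftrightarrow> is_meet x y m"
proof
  assume m: "is_meet_in {a..} x y m"
  have "l \<le> m" if "l \<le> x" "l \<le> y" for l
  proof -
    have "sup l a \<in> {a..}" "sup l a \<le> x" "sup l a \<le> y"
      using that assms by simp_all
    then have "sup l a \<le> m"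
      using m unfolding is_meet_in_def by blast
    then show ?thesis by simp
  qed
  then show "is_meet x y m"
    using m by (simp add: is_meet_in_def)
next
  assume "is_meet x y m"
  then show "is_meet_in {a..} x y m"
    using assms by (simp add: is_meet_in_def)
qed

lemma is_meet_exists:
  assumes "a \<le> x" "a \<le> y"
  obtains m where "is_meet x y m"
  using principal_filter_meet_exists[of x a y] assms
  by (auto simp: is_meet_in_principal_filter_iff)

lemma is_meet_sup_distrib:
  assumes "a \<le> x" "a \<le> y" "a \<le> z"
    and "is_meet x (sup y z) m" "is_meet x y p" "is_meet x z q"
  shows "m = sup p q"
  using principal_filter_distrib[of x a y z m p q] assms
  by (simp add: is_meet_in_principal_filter_iff le_supI1)

lemma is_meet_commute: "is_meet x y m \<longleftrightarrow> is_meet y x m"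
  by (auto simp: is_meet_in_def)

lemma is_meet_absorb: "x \<le> y \<Longrightarrow> is_meet x y x"
  by (simp add: is_meet_in_def)

text \<open>The dual distributive law, obtained as in lattices by expanding
  \<open>(Y \<squnion> f) \<sqinter> (Y \<squnion> g)\<close> inside \<open>{m..}\<close>.\<close>

lemma sup_is_meet_distrib:
  assumes m: "is_meet f g m"
  shows "is_meet (sup y f) (sup y g) (sup y m)"
proof -
  \<comment> \<open>\<open>y\<close> need not lie above \<open>m\<close>; adding \<open>m\<close>
    moves it into \<open>{m..}\<close> and leaves its joins with \<open>f\<close> and
    \<open>g\<close> unchanged.\<close>
  define Y where "Y = sup y m"
  have le: "m \<le> f" "m \<le> g" "m \<le> Y"
    using m by (auto simp: is_meet_in_def Y_def)
  have Yf: "sup Y f = sup y f" and Yg: "sup Y g = sup y g"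
    using le by (simp_all add: Y_def sup.assoc sup_absorb2)
  obtain p where p: "is_meet (sup Y f) (sup Y g) p"
    using is_meet_exists[of Y "sup Y f" "sup Y g"] by auto
  obtain q where q: "is_meet g (sup Y f) q"
    using is_meet_exists[of m g "sup Y f"] le by (auto intro: le_supI1)
  obtain r where r: "is_meet g Y r"
    using is_meet_exists[of m g Y] le by auto
  \<comment> \<open>Distribute \<open>Y \<squnion> f\<close> over \<open>Y \<squnion> g\<close>;
    absorption turns the first term into \<open>Y\<close>.\<close>
  have "p = sup Y q"
  proof (rule is_meet_sup_distrib[OF _ _ _ p])
    show "is_meet (sup Y f) Y Y"
      using is_meet_absorb[of Y "sup Y f"] by (simp add: is_meet_commute)
    show "is_meet (sup Y f) g q"
      using q by (simp add: is_meet_commute)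
    show "m \<le> sup Y f" "m \<le> Y" "m \<le> g"
      using le by (auto intro: le_supI1)
  qed
  \<comment> \<open>Distribute \<open>g\<close> over \<open>Y \<squnion> f\<close>. Both resulting
    terms, \<open>r\<close> and \<open>m\<close>, are below \<open>Y\<close>, so \<open>p\<close>
    collapses to \<open>Y\<close>.\<close>
  moreover have "q = sup r m"
    using is_meet_sup_distrib[OF _ _ _ q r] m le by (simp add: is_meet_commute)
  moreover have "r \<le> Y"
    using r by (simp add: is_meet_in_def)
  ultimately have "p = Y"
    using le by (simp add: sup_absorb1)
  then show ?thesis
    using p Yf Yg by (simp add: Y_def)
qed

text \<open>\<open>sup y m\<close> is the meet of \<open>sup y f\<close> and \<open>sup y g\<close>,
  and a meet is \<open>top\<close> exactly when both of its arguments are.\<close>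

lemma ann_is_meet:
  assumes "is_meet f g m"
  shows "ann m = ann f \<inter> ann g"
proof -
  have "sup y m = top \<longleftrightarrow> sup y f = top \<and> sup y g = top" for y
    using sup_is_meet_distrib[OF assms, of y] unfolding is_meet_in_def
    by (metis UNIV_I order_refl top_unique)
  then show ?thesis by (auto simp: ann_def)
qed

lemma nl_filterD:
  assumes "nl_filter F"
  shows "top \<in> F"
    and "a \<in> F \<Longrightarrow> a \<le> b \<Longrightarrow> b \<in> F"
    and "a \<in> F \<Longrightarrow> b \<in> F \<Longrightarrow> is_meet a b m \<Longrightarrow> m \<in> F"
  using assms unfolding nl_filter_def by blast+

lemma nl_filter_meets:
  assumes F: "nl_filter F" and G: "nl_filter G"
  shows "nl_filter {m. \<exists>f\<in>F. \<exists>g\<in>G. is_meet f g m}" (is "nl_filter ?H")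
  unfolding nl_filter_def
proof (intro conjI ballI allI impI)
  show "top \<in> ?H"
    using nl_filterD(1)[OF F] nl_filterD(1)[OF G] is_meet_absorb[of top top] by auto
next
  fix a b assume "a \<in> ?H" and ab: "a \<le> b"
  then obtain f g where fg: "f \<in> F" "g \<in> G" "is_meet f g a" by auto
  \<comment> \<open>Joining \<open>f \<sqinter> g = a\<close> with \<open>b\<close> gives
    \<open>sup b a = b\<close>, so \<open>b\<close> is again a meet of the required form.\<close>
  have "is_meet (sup b f) (sup b g) b"
    using sup_is_meet_distrib[OF fg(3), of b] ab by (simp add: sup_absorb1)
  moreover have "sup b f \<in> F" "sup b g \<in> G"
    using nl_filterD(2)[OF F fg(1)] nl_filterD(2)[OF G fg(2)] by auto
  ultimately show "b \<in> ?H" by auto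
next
  fix a b m assume "a \<in> ?H" "b \<in> ?H" and m: "is_meet a b m"
  then obtain f g f' g' where fg: "f \<in> F" "g \<in> G" "is_meet f g a"
    and fg': "f' \<in> F" "g' \<in> G" "is_meet f' g' b" by auto
  have le: "m \<le> f" "m \<le> f'" "m \<le> g" "m \<le> g'"
    using m fg(3) fg'(3) unfolding is_meet_in_def by (meson order_trans)+
  \<comment> \<open>Regroup \<open>(f \<sqinter> g) \<sqinter> (f' \<sqinter> g')\<close> by filter;
    the new inner meets exist because \<open>m\<close> bounds all four elements from below.\<close>
  obtain p q where p: "is_meet f f' p" and q: "is_meet g g' q"
    using is_meet_exists[OF le(1,2)] is_meet_exists[OF le(3,4)] by metis
  have "l \<le> m" if "l \<le> p" "l \<le> q" for l
  proof -
    have "l \<le> f" "l \<le> f'" "l \<le> g" "l \<le> g'"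
      using that p q unfolding is_meet_in_def by (meson order_trans)+
    then show ?thesis
      using m fg(3) fg'(3) by (simp add: is_meet_in_def)
  qed
  then have "is_meet p q m"
    using p q le by (simp add: is_meet_in_def)
  moreover have "p \<in> F" "q \<in> G"
    using nl_filterD(3)[OF F fg(1) fg'(1) p] nl_filterD(3)[OF G fg(2) fg'(2) q] by auto
  ultimately show "m \<in> ?H" by auto
qed

lemma mem_filter_join_iff:
  assumes F: "nl_filter F" and G: "nl_filter G"
  shows "a \<in> filter_join F G \<longleftrightarrow> (\<exists>f\<in>F. \<exists>g\<in>G. is_meet f g a)"
proof
  \<comment> \<open>Each element is its own meet with \<open>top\<close>, which belongs to both
    filters.\<close>
  have "F \<union> G \<subseteq> {m. \<exists>f\<in>F. \<exists>g\<in>G. is_meet f g m}"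
    using nl_filterD(1)[OF F] nl_filterD(1)[OF G] is_meet_absorb[OF top_greatest]
      is_meet_commute by blast
  then show "a \<in> filter_join F G \<Longrightarrow> \<exists>f\<in>F. \<exists>g\<in>G. is_meet f g a"
    using nl_filter_meets[OF F G] unfolding filter_join_def by blast
next
  show "\<exists>f\<in>F. \<exists>g\<in>G. is_meet f g a \<Longrightarrow> a \<in> filter_join F G"
    unfolding filter_join_def using nl_filterD(3) by blast
qed

lemma mem_set_ann_iff: "x \<in> set_ann H \<longleftrightarrow> H \<subseteq> ann x"
  by (auto simp: set_ann_def ann_def sup.commute)

lemma alpha_filter_join:
  assumes F: "nl_filter F" and G: "nl_filter G"
  shows "alpha (filter_join F G) = {x. \<exists>f\<in>F. \<exists>g\<in>G. x \<in> set_ann (ann f \<inter> ann g)}"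
proof (intro equalityI subsetI)
  fix x assume "x \<in> alpha (filter_join F G)"
  then obtain f g a where fg: "f \<in> F" "g \<in> G" "is_meet f g a" and "ann a \<subseteq> ann x"
    by (auto simp: alpha_def mem_filter_join_iff[OF F G])
  then have "x \<in> set_ann (ann f \<inter> ann g)"
    by (simp add: mem_set_ann_iff ann_is_meet)
  then show "x \<in> {x. \<exists>f\<in>F. \<exists>g\<in>G. x \<in> set_ann (ann f \<inter> ann g)}"
    using fg by blast
next
  fix x assume "x \<in> {x. \<exists>f\<in>F. \<exists>g\<in>G. x \<in> set_ann (ann f \<inter> ann g)}"
  then obtain f g where fg: "f \<in> F" "g \<in> G" and sub: "ann f \<inter> ann g \<subseteq> ann x"
    by (auto simp: mem_set_ann_iff)
  obtain a where a: "is_meet (sup x f) (sup x g) a"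
    using is_meet_exists[of x "sup x f" "sup x g"] by auto
  have "sup x f \<in> F" "sup x g \<in> G"
    using nl_filterD(2)[OF F fg(1)] nl_filterD(2)[OF G fg(2)] by auto
  then have "a \<in> filter_join F G"
    using a mem_filter_join_iff[OF F G] by blast
  moreover have "ann a \<subseteq> ann x"
  proof
    fix y assume "y \<in> ann a"
    \<comment> \<open>By \<open>ann_is_meet\<close>, \<open>y\<close> annihilates both
      \<open>sup x f\<close> and \<open>sup x g\<close>; reassociating shifts \<open>x\<close> over
      to \<open>y\<close>.\<close>
    then have "sup y x \<in> ann f \<inter> ann g"
      by (simp add: ann_is_meet[OF a]) (simp add: ann_def sup.assoc)
    then have "sup y x \<in> ann x" using sub by blast
    then show "y \<in> ann x" by (simp add: ann_def sup.assoc)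
  qed
  ultimately show "x \<in> alpha (filter_join F G)"
    by (auto simp: alpha_def)
qed

end

theorem theorem3p11:
  fixes F G :: "'a::{normal_nearlattice, quasicomplemented_nearlattice} set"
  assumes "alpha_filter F" and "alpha_filter G"
  shows "alpha (filter_join F G) =
    {x. \<exists>(f, g)\<in>F \<times> G. x \<in> set_ann (ann f \<inter> ann g)}"
  using assms by (simp add: alpha_filter_def alpha_filter_join)

end
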